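(* Let $q$ be an odd prime power, let $n$ be a positive integer, and let $F_q$ be the field with $q$ elements. Let $\mathcal{F} \subseteq \mathrm{sub}(F_q^n)$ be a family of subspaces such that $\dim(A)$ is odd for all $A \in \mathcal{F}$ and $\dim(A \cap B)$ is even for all $A, B \in \mathcal{F}$ with $A \neq B$. Then $|\mathcal{F}| \leq [n]_q$.
   Context: $\mathrm{sub}(F_q^n)$ denotes the set of all linear subspaces of the $n$-dimensional vector space $F_q^n$ over $F_q$. For a positive integer $n$, $[n]_q := \frac{1-q^n}{1-q} = 1 + q + q^2 + \cdots + q^{n-1}$. The number $0$ is even. *)

theory Defs
  imports "HOL-Analysis.Cartesian_Space" "HOL-Number_Theory.Prime_Powers"
begin

definition sub :: "('a::field ^ 'n::finite) set set" where
  "sub = {A. vec.subspace A}"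

definition q_int :: "'a::comm_semiring_1 \<Rightarrow> nat \<Rightarrow> 'a" where
  "q_int q n = (\<Sum>i<n. q ^ i)"

lemma q_int_eq_quotient:
  fixes q :: "'a::field"
  assumes "q \<noteq> 1"
  shows "q_int q n = (1 - q ^ n) / (1 - q)"
  using assms by (simp add: q_int_def one_diff_power_eq)

lemma of_nat_q_int: "of_nat (q_int q n) = q_int (of_nat q) n"
  by (simp add: q_int_def)

end

theory Submission imports Defs begin

text \<open>
  Oddtown for lines: since \<open>q\<close> is odd, the number \<open>[k]\<^sub>q\<close> of lines in a \<open>k\<close>-dimensional subspace
  has the parity of \<open>k\<close>. Hence sending each member of the family to its set of lines yields an
  oddtown family on the \<open>[n]\<^sub>q\<close> lines of the whole space.
\<close>

text \<open>
  Sending a subfamily to the symmetric difference of its members is injective, because the parity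
  of the intersection with \<open>S i\<close> recovers whether \<open>i\<close> belongs to the subfamily.
\<close>

lemma oddtown:
  fixes S :: "'i \<Rightarrow> 'b set"
  assumes "finite I" and "finite X"
    and sub: "\<And>i. i \<in> I \<Longrightarrow> S i \<subseteq> X"
    and odd: "\<And>i. i \<in> I \<Longrightarrow> odd (card (S i))"
    and even: "\<And>i j. i \<in> I \<Longrightarrow> j \<in> I \<Longrightarrow> i \<noteq> j \<Longrightarrow> even (card (S i \<inter> S j))"
  shows "card I \<le> card X"
proof -
  define \<phi> where "\<phi> J = {x \<in> X. odd (card {j \<in> J. x \<in> S j})}" for J
  have fin: "finite (S i)" if "i \<in> I" for i
    using sub[OF that] \<open>finite X\<close> finite_subset by blast
  have parity: "odd (card (S i \<inter> \<phi> J)) \<longleftrightarrow> i \<in> J" if i: "i \<in> I" and J: "J \<subseteq> I" for i J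
  proof -
    have finJ: "finite J"
      using J \<open>finite I\<close> finite_subset by blast
    have "S i \<inter> \<phi> J = {x \<in> S i. odd (card {j \<in> J. x \<in> S j})}"
      using sub[OF i] by (auto simp: \<phi>_def)
    \<comment> \<open>A sum of naturals is odd exactly when it has an odd number of odd terms. This
      trades the parity condition in \<open>\<phi> J\<close> for a plain sum that can be double
      counted; the same fact is used in reverse below.\<close>
    then have "odd (card (S i \<inter> \<phi> J)) \<longleftrightarrow> odd (\<Sum>x\<in>S i. card {j \<in> J. x \<in> S j})"
      using fin[OF i] by (simp add: even_sum_iff)
    also have "(\<Sum>x\<in>S i. card {j \<in> J. x \<in> S j}) = (\<Sum>j\<in>J. card {x \<in> S i. x \<in> S j})"
      using sum_multicount_gen[of "S i" J "\<lambda>x j. x \<in> S j" "\<lambda>j. card {x \<in> S i. x \<in> S j}"]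
        fin[OF i] finJ by simp
    also have "\<dots> = (\<Sum>j\<in>J. card (S i \<inter> S j))"
      by (simp add: Int_def)
    also have "odd \<dots> \<longleftrightarrow> odd (card {j \<in> J. odd (card (S i \<inter> S j))})"
      using finJ by (simp add: even_sum_iff)
    \<comment> \<open>Only \<open>j = i\<close> can contribute an odd intersection, so the count is
      1 or 0 according to whether \<open>i\<close> lies in \<open>J\<close>.\<close>
    also have "{j \<in> J. odd (card (S i \<inter> S j))} = J \<inter> {i}"
      using odd[OF i] even[OF i] J by auto
    finally show ?thesis
      by (auto simp: Int_insert_right)
  qed
  have "inj_on \<phi> (Pow I)"
    using parity by (intro inj_onI) (metis PowD equalityI subset_eq)
  then have "card (Pow I) \<le> card (Pow X)"
    using \<open>finite X\<close> by (intro card_inj_on_le[of \<phi>]) (auto simp: \<phi>_def)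
  then show ?thesis
    using \<open>finite I\<close> \<open>finite X\<close> by (simp add: card_Pow)
qed

text \<open>Coordinates with respect to a basis \<open>B\<close> of \<open>A\<close> give a
  bijection between functions from \<open>B\<close> to the field and \<open>A\<close>: independence
  makes it injective, spanning makes it onto.\<close>

lemma card_subspace:
  fixes A :: "('a::{field,finite} ^ 'n::finite) set"
  assumes "vec.subspace A"
  shows "card A = CARD('a) ^ vec.dim A"
proof -
  obtain B where B: "B \<subseteq> A" "vec.independent B" "A \<subseteq> vec.span B" "card B = vec.dim A"
    using vec.basis_exists by blast
  have span: "vec.span B = A"
    using B assms vec.span_minimal by blast
  define f where "f c = (\<Sum>b\<in>B. c b *s b)" for c :: "'a ^ 'n \<Rightarrow> 'a"
  have "inj_on f (B \<rightarrow>\<^sub>E UNIV)"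
  proof (rule inj_onI)
    fix c d assume c: "c \<in> B \<rightarrow>\<^sub>E UNIV" and d: "d \<in> B \<rightarrow>\<^sub>E UNIV" and "f c = f d"
    then have "(\<Sum>b\<in>B. (c b - d b) *s b) = 0"
      by (simp add: f_def vec.scale_left_diff_distrib sum_subtractf)
    then have "c b - d b = 0" if "b \<in> B" for b
      using vec.independentD[OF B(2) finite subset_refl _ that, of "\<lambda>b. c b - d b"] by blast
    then show "c = d"
      using c d by (intro PiE_ext) auto
  qed
  moreover have "f ` (B \<rightarrow>\<^sub>E UNIV) = A"
  proof -
    \<comment> \<open>\<open>f\<close> depends only on the values on \<open>B\<close>, so passing to
      extensional functions, which can be counted, loses nothing of the span.\<close>
    have "f c = f (restrict c B)" for c
      by (simp add: f_def)
    then have "f ` (B \<rightarrow>\<^sub>E UNIV) = range f"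
      by (auto intro!: image_eqI[where x = "restrict _ B"])
    also have "\<dots> = A"
      using vec.span_finite[of B] span by (simp add: f_def)
    finally show ?thesis .
  qed
  ultimately have "card A = card (B \<rightarrow>\<^sub>E (UNIV :: 'a set))"
    using card_image by fastforce
  then show ?thesis
    using B(4) by (simp add: card_PiE)
qed

definition lines :: "('a::field ^ 'n::finite) set \<Rightarrow> ('a ^ 'n) set set" where
  "lines A = {l. vec.subspace l \<and> vec.dim l = 1 \<and> l \<subseteq> A}"

lemma lines_Int: "lines (A \<inter> B) = lines A \<inter> lines B"
  by (auto simp: lines_def)

text \<open>A nonzero vector of a line already spans dimension 1 inside it. Hence distinct lines
  meet only in 0, which \<open>card_lines\<close> uses for disjointness.\<close>

lemma span_singleton_eqI:
  fixes l :: "('a::field ^ 'n::finite) set"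
  assumes "vec.subspace l" and "vec.dim l = 1" and "v \<in> l" and "v \<noteq> 0"
  shows "vec.span {v} = l"
proof (rule vec.subspace_dim_equal)
  show "vec.span {v} \<subseteq> l"
    using assms by (simp add: vec.span_minimal)
  show "vec.dim l \<le> vec.dim (vec.span {v})"
    using assms vec.dim_eq_card_independent[of "{v}"] by simp
qed (use assms in auto)

text \<open>The lines of \<open>A\<close>, punctured at 0, partition \<open>A - {0}\<close> into
  blocks of size \<open>q - 1\<close>, where \<open>q\<close> is the size of the field. Comparing
  sizes and cancelling \<open>q - 1\<close> gives the count.\<close>

lemma card_lines:
  fixes A :: "('a::{field,finite} ^ 'n::finite) set"
  assumes A: "vec.subspace A"
  shows "card (lines A) = q_int CARD('a) (vec.dim A)"
proof -
  let ?q = "CARD('a)"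
  have q: "?q > 1"
    using card_mono[of UNIV "{0, 1 :: 'a}"] by simp
  have punctured: "card (B - {0}) = ?q ^ vec.dim B - 1" if "vec.subspace B"
    for B :: "('a ^ 'n) set"
    using card_subspace[OF that] vec.subspace_0[OF that] by simp
  have union: "A - {0} = (\<Union>l\<in>lines A. l - {0})"
  proof (intro equalityI subsetI)
    fix v assume v: "v \<in> A - {0}"
    then have "vec.span {v} \<in> lines A"
      using A vec.dim_eq_card_independent[of "{v}"] by (simp add: lines_def vec.span_minimal)
    then show "v \<in> (\<Union>l\<in>lines A. l - {0})"
      using v vec.span_base[of v "{v}"] by blast
  qed (auto simp: lines_def)
  have "card (A - {0}) = (\<Sum>l\<in>lines A. card (l - {0}))"
    unfolding union
  proof (rule card_UN_disjoint)
    show "\<forall>l\<in>lines A. \<forall>m\<in>lines A. l \<noteq> m \<longrightarrow> (l - {0}) \<inter> (m - {0}) = {}"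
    proof (intro ballI impI)
      fix l m assume "l \<in> lines A" "m \<in> lines A" "l \<noteq> m"
      then have "v \<notin> m" if "v \<in> l" "v \<noteq> 0" for v
        using span_singleton_eqI[of l v] span_singleton_eqI[of m v] that by (auto simp: lines_def)
      then show "(l - {0}) \<inter> (m - {0}) = {}"
        by blast
    qed
  qed auto
  also have "\<dots> = (\<Sum>l\<in>lines A. ?q - 1)"
    using punctured by (intro sum.cong) (auto simp: lines_def)
  finally have "(?q - 1) * card (lines A) = ?q ^ vec.dim A - 1"
    using punctured[OF A] by simp
  also have "\<dots> = (?q - 1) * q_int ?q (vec.dim A)"
  proof -
    \<comment> \<open>The geometric sum is evaluated over the integers because subtraction on
      naturals truncates; \<open>?q > 1\<close> makes both differences genuine.\<close>
    have "int (?q ^ vec.dim A - 1) = int ((?q - 1) * q_int ?q (vec.dim A))"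
      using q power_diff_1_eq[of "int ?q" "vec.dim A"] by (simp add: q_int_def of_nat_diff)
    then show ?thesis
      by (simp only: of_nat_eq_iff)
  qed
  finally show ?thesis
    using q by simp
qed

text \<open>All \<open>k\<close> summands are powers of an odd number, hence odd.\<close>

lemma even_q_int_iff:
  fixes q :: nat
  assumes "odd q"
  shows "even (q_int q k) \<longleftrightarrow> even k"
  using assms by (simp add: q_int_def even_sum_iff)

theorem theorem1p4:
  fixes q n :: nat
    and F :: "('a::{field,finite} ^ 'n::finite) set set"
  assumes "primepow q" and "odd q" and "CARD('a) = q"
    and "n > 0" and "CARD('n) = n"
    and "F \<subseteq> sub"
    and "\<And>A. A \<in> F \<Longrightarrow> odd (vec.dim A)"
    and "\<And>A B. A \<in> F \<Longrightarrow> B \<in> F \<Longrightarrow> A \<noteq> B \<Longrightarrow> even (vec.dim (A \<inter> B))"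
  shows "card F \<le> q_int q n"
proof -
  have subspace: "vec.subspace A" if "A \<in> F" for A
    using that assms(6) by (auto simp: sub_def)
  have parity: "even (card (lines A)) \<longleftrightarrow> even (vec.dim A)" if "vec.subspace A"
    for A :: "('a ^ 'n) set"
    using card_lines[OF that] even_q_int_iff[OF assms(2)] assms(3) by simp
  have "card F \<le> card (lines (UNIV :: ('a ^ 'n) set))"
  \<comment> \<open>The set system is indexed by \<open>F\<close> itself, so the bound concerns
    \<open>card F\<close> directly, with no separate argument that \<open>lines\<close> is
    injective.\<close>
  proof (rule oddtown[where S = lines])
    show "odd (card (lines A))" if "A \<in> F" for A
      using parity[OF subspace[OF that]] assms(7)[OF that] by simp
    show "even (card (lines A \<inter> lines B))" if "A \<in> F" "B \<in> F" "A \<noteq> B" for A B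
      using parity[OF vec.subspace_inter[OF subspace subspace], OF that(1,2)] assms(8)[OF that]
      by (simp add: lines_Int)
  qed (auto simp: lines_def)
  also have "\<dots> = q_int q n"
    using card_lines[OF vec.subspace_UNIV, where 'a = 'a and 'n = 'n] assms(3,5)
    by (simp add: vec.dim_UNIV card_cart_basis)
  finally show ?thesis .
qed

end
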